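(* Let $\mathbf A=\langle A,\wedge,\vee,\rightarrow,0,1\rangle$ be a connexive Heyting algebra and define $a\Rightarrow b:=a\rightarrow(a\wedge b)$ for $a,b\in A$. Then $\mathbb{H}(\mathbf A)=\langle A,\wedge,\vee,\Rightarrow,0,1\rangle$ is a Heyting algebra.
   Context: A connexive Heyting algebra is an algebra $\mathbf A=\langle A,\wedge,\vee,\rightarrow,0,1\rangle$ of type $\langle 2,2,2,0,0\rangle$ such that $\langle A,\wedge,\vee,0,1\rangle$ is a bounded distributive lattice with bottom $0$, top $1$ and lattice order $\le$, and, writing $\neg x:=x\rightarrow 0$, the following hold for all elements: (C1) $(x\rightarrow y)\rightarrow((y\rightarrow z)\rightarrow(x\rightarrow z))=1$; (C2) $(x\rightarrow y)\rightarrow\neg(x\rightarrow\neg y)=1$; (C3) $x\wedge(x\rightarrow y)=x\wedge y$; (C4) $x\rightarrow y\le(z\wedge x)\rightarrow(z\wedge y)$; (C5) $x\rightarrow y\le(z\vee x)\rightarrow(z\vee y)$. *)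

theory Defs
  imports "HOL-Algebra.Congruence"
begin

record 'a impl_algebra = "'a partial_object" +
  meet :: "'a \<Rightarrow> 'a \<Rightarrow> 'a" (infixl \<open>\<sqinter>\<index>\<close> 70)
  join :: "'a \<Rightarrow> 'a \<Rightarrow> 'a" (infixl \<open>\<squnion>\<index>\<close> 65)
  impl :: "'a \<Rightarrow> 'a \<Rightarrow> 'a" (infixr \<open>\<leadsto>\<index>\<close> 60)
  zero :: 'a (\<open>\<zero>\<index>\<close>)
  one :: 'a (\<open>\<one>\<index>\<close>)

definition le :: "('a, 'm) impl_algebra_scheme \<Rightarrow> 'a \<Rightarrow> 'a \<Rightarrow> bool" (infix \<open>\<sqsubseteq>\<index>\<close> 50)
  where "x \<sqsubseteq>\<^bsub>A\<^esub> y \<longleftrightarrow> x \<sqinter>\<^bsub>A\<^esub> y = x"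

definition neg :: "('a, 'm) impl_algebra_scheme \<Rightarrow> 'a \<Rightarrow> 'a" (\<open>\<sim>\<index> _\<close> [81] 80)
  where "\<sim>\<^bsub>A\<^esub> x = x \<leadsto>\<^bsub>A\<^esub> \<zero>\<^bsub>A\<^esub>"

text \<open>Algebras of type \<open>(2,2,2,0,0)\<close> whose reduct without the implication is a bounded
  distributive lattice; about the implication only closure is required.\<close>

locale bounded_distrib_lattice_impl =
  fixes A :: "('a, 'm) impl_algebra_scheme" (structure)
  assumes meet_closed: "\<lbrakk>x \<in> carrier A; y \<in> carrier A\<rbrakk> \<Longrightarrow> x \<sqinter> y \<in> carrier A"
    and join_closed: "\<lbrakk>x \<in> carrier A; y \<in> carrier A\<rbrakk> \<Longrightarrow> x \<squnion> y \<in> carrier A"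
    and impl_closed: "\<lbrakk>x \<in> carrier A; y \<in> carrier A\<rbrakk> \<Longrightarrow> x \<leadsto> y \<in> carrier A"
    and zero_closed: "\<zero> \<in> carrier A"
    and one_closed: "\<one> \<in> carrier A"
    and meet_comm: "\<lbrakk>x \<in> carrier A; y \<in> carrier A\<rbrakk> \<Longrightarrow> x \<sqinter> y = y \<sqinter> x"
    and join_comm: "\<lbrakk>x \<in> carrier A; y \<in> carrier A\<rbrakk> \<Longrightarrow> x \<squnion> y = y \<squnion> x"
    and meet_assoc: "\<lbrakk>x \<in> carrier A; y \<in> carrier A; z \<in> carrier A\<rbrakk>
      \<Longrightarrow> (x \<sqinter> y) \<sqinter> z = x \<sqinter> (y \<sqinter> z)"
    and join_assoc: "\<lbrakk>x \<in> carrier A; y \<in> carrier A; z \<in> carrier A\<rbrakk>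
      \<Longrightarrow> (x \<squnion> y) \<squnion> z = x \<squnion> (y \<squnion> z)"
    and meet_join_absorb: "\<lbrakk>x \<in> carrier A; y \<in> carrier A\<rbrakk> \<Longrightarrow> x \<sqinter> (x \<squnion> y) = x"
    and join_meet_absorb: "\<lbrakk>x \<in> carrier A; y \<in> carrier A\<rbrakk> \<Longrightarrow> x \<squnion> (x \<sqinter> y) = x"
    and meet_join_distrib: "\<lbrakk>x \<in> carrier A; y \<in> carrier A; z \<in> carrier A\<rbrakk>
      \<Longrightarrow> x \<sqinter> (y \<squnion> z) = (x \<sqinter> y) \<squnion> (x \<sqinter> z)"
    and zero_least: "x \<in> carrier A \<Longrightarrow> \<zero> \<sqsubseteq> x"
    and one_greatest: "x \<in> carrier A \<Longrightarrow> x \<sqsubseteq> \<one>"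

locale connexive_heyting_algebra = bounded_distrib_lattice_impl +
  assumes C1: "\<lbrakk>x \<in> carrier A; y \<in> carrier A; z \<in> carrier A\<rbrakk>
      \<Longrightarrow> (x \<leadsto> y) \<leadsto> ((y \<leadsto> z) \<leadsto> (x \<leadsto> z)) = \<one>"
    and C2: "\<lbrakk>x \<in> carrier A; y \<in> carrier A\<rbrakk>
      \<Longrightarrow> (x \<leadsto> y) \<leadsto> \<sim> (x \<leadsto> \<sim> y) = \<one>"
    and C3: "\<lbrakk>x \<in> carrier A; y \<in> carrier A\<rbrakk> \<Longrightarrow> x \<sqinter> (x \<leadsto> y) = x \<sqinter> y"
    and C4: "\<lbrakk>x \<in> carrier A; y \<in> carrier A; z \<in> carrier A\<rbrakk>
      \<Longrightarrow> x \<leadsto> y \<sqsubseteq> (z \<sqinter> x) \<leadsto> (z \<sqinter> y)"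
    and C5: "\<lbrakk>x \<in> carrier A; y \<in> carrier A; z \<in> carrier A\<rbrakk>
      \<Longrightarrow> x \<leadsto> y \<sqsubseteq> (z \<squnion> x) \<leadsto> (z \<squnion> y)"

locale heyting_algebra = bounded_distrib_lattice_impl +
  assumes residuation: "\<lbrakk>x \<in> carrier A; y \<in> carrier A; z \<in> carrier A\<rbrakk>
      \<Longrightarrow> x \<sqinter> y \<sqsubseteq> z \<longleftrightarrow> x \<sqsubseteq> y \<leadsto> z"

definition heyting_of :: "('a, 'm) impl_algebra_scheme \<Rightarrow> ('a, 'm) impl_algebra_scheme" (\<open>\<H>\<close>)
  where "\<H> A = A\<lparr>impl := \<lambda>a b. a \<leadsto>\<^bsub>A\<^esub> (a \<sqinter>\<^bsub>A\<^esub> b)\<rparr>"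

end

theory Submission
  imports Defs
begin

text \<open>By (C3), \<open>1 \<rightarrow> x = x\<close>, so (C4) gives \<open>x \<le> y \<rightarrow> (y \<and> x)\<close>. If \<open>x \<and> y \<le> z\<close>, then
  joining with \<open>y \<and> z\<close> through (C5) fixes the antecedent \<open>y\<close> and turns the consequent
  \<open>y \<and> x\<close> into \<open>y \<and> z\<close>, whence \<open>x \<le> y \<Rightarrow> z\<close>. The converse is modus ponens, i.e. (C3).\<close>

lemma le_impl_update [simp]: "x \<sqsubseteq>\<^bsub>A\<lparr>impl := f\<rparr>\<^esub> y \<longleftrightarrow> x \<sqsubseteq>\<^bsub>A\<^esub> y"
  by (simp add: le_def)

context bounded_distrib_lattice_impl
begin

declare meet_closed [simp] join_closed [simp] impl_closed [simp] zero_closed [simp] one_closed [simp]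

lemma bounded_distrib_lattice_impl_update:
  assumes "\<And>x y. \<lbrakk>x \<in> carrier A; y \<in> carrier A\<rbrakk> \<Longrightarrow> f x y \<in> carrier A"
  shows "bounded_distrib_lattice_impl (A\<lparr>impl := f\<rparr>)"
  by unfold_locales (auto intro: assms meet_comm join_comm meet_assoc join_assoc
      meet_join_absorb join_meet_absorb meet_join_distrib zero_least one_greatest)

lemma meet_idem:
  assumes "x \<in> carrier A"
  shows "x \<sqinter> x = x"
proof -
  have "x \<sqinter> x = x \<sqinter> (x \<squnion> (x \<sqinter> x))"
    using assms by (simp add: join_meet_absorb)
  also have "\<dots> = x"
    using assms by (simp add: meet_join_absorb)
  finally show ?thesis .
qed

lemma le_trans:
  assumes "x \<in> carrier A" "y \<in> carrier A" "z \<in> carrier A" "x \<sqsubseteq> y" "y \<sqsubseteq> z"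
  shows "x \<sqsubseteq> z"
  using assms by (metis le_def meet_assoc)

lemma meet_le1:
  assumes "x \<in> carrier A" "y \<in> carrier A"
  shows "x \<sqinter> y \<sqsubseteq> x"
  using assms unfolding le_def by (metis meet_assoc meet_comm meet_idem)

lemma meet_le2:
  assumes "x \<in> carrier A" "y \<in> carrier A"
  shows "x \<sqinter> y \<sqsubseteq> y"
  using assms by (metis meet_comm meet_le1)

lemma le_meet_iff:
  assumes "x \<in> carrier A" "y \<in> carrier A" "z \<in> carrier A"
  shows "x \<sqsubseteq> y \<sqinter> z \<longleftrightarrow> x \<sqsubseteq> y \<and> x \<sqsubseteq> z"
proof
  assume "x \<sqsubseteq> y \<sqinter> z"
  with assms show "x \<sqsubseteq> y \<and> x \<sqsubseteq> z"
    by (meson le_trans meet_closed meet_le1 meet_le2)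
next
  assume "x \<sqsubseteq> y \<and> x \<sqsubseteq> z"
  with assms show "x \<sqsubseteq> y \<sqinter> z"
    by (metis le_def meet_assoc)
qed

lemma le_iff_join_eq:
  assumes "x \<in> carrier A" "y \<in> carrier A"
  shows "x \<sqsubseteq> y \<longleftrightarrow> x \<squnion> y = y"
  using assms unfolding le_def by (metis join_comm join_meet_absorb meet_comm meet_join_absorb)

lemma one_meet:
  assumes "x \<in> carrier A"
  shows "\<one> \<sqinter> x = x"
  using assms by (metis le_def meet_comm one_closed one_greatest)

end

locale compatible_impl_lattice = bounded_distrib_lattice_impl +
  assumes meet_impl: "\<lbrakk>x \<in> carrier A; y \<in> carrier A\<rbrakk> \<Longrightarrow> x \<sqinter> (x \<leadsto> y) = x \<sqinter> y"
    and impl_le_meet_impl_meet: "\<lbrakk>x \<in> carrier A; y \<in> carrier A; z \<in> carrier A\<rbrakk>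
      \<Longrightarrow> x \<leadsto> y \<sqsubseteq> (z \<sqinter> x) \<leadsto> (z \<sqinter> y)"
    and impl_le_join_impl_join: "\<lbrakk>x \<in> carrier A; y \<in> carrier A; z \<in> carrier A\<rbrakk>
      \<Longrightarrow> x \<leadsto> y \<sqsubseteq> (z \<squnion> x) \<leadsto> (z \<squnion> y)"
begin

lemma one_impl:
  assumes "x \<in> carrier A"
  shows "\<one> \<leadsto> x = x"
  using assms meet_impl[of \<one> x] by (simp add: one_meet)

lemma le_impl_meet:
  assumes "x \<in> carrier A" "y \<in> carrier A"
  shows "x \<sqsubseteq> y \<leadsto> (y \<sqinter> x)"
proof -
  have "\<one> \<leadsto> x \<sqsubseteq> (y \<sqinter> \<one>) \<leadsto> (y \<sqinter> x)"
    using assms by (simp add: impl_le_meet_impl_meet)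
  then show ?thesis
    using assms by (simp add: one_impl one_meet meet_comm[of y \<one>])
qed

lemma impl_mono_below_antecedent:
  assumes "a \<in> carrier A" "b \<in> carrier A" "y \<in> carrier A" and "a \<sqsubseteq> b" "b \<sqsubseteq> y"
  shows "y \<leadsto> a \<sqsubseteq> y \<leadsto> b"
proof -
  have "y \<leadsto> a \<sqsubseteq> (b \<squnion> y) \<leadsto> (b \<squnion> a)"
    using assms by (simp add: impl_le_join_impl_join)
  moreover have "b \<squnion> y = y" "b \<squnion> a = b"
    using assms by (simp_all add: le_iff_join_eq join_comm[of b a])
  ultimately show ?thesis
    by simp
qed

lemma le_impl_meet_if_meet_le:
  assumes "x \<in> carrier A" "y \<in> carrier A" "z \<in> carrier A" and "x \<sqinter> y \<sqsubseteq> z"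
  shows "x \<sqsubseteq> y \<leadsto> (y \<sqinter> z)"
proof -
  have "y \<sqinter> x \<sqsubseteq> y \<sqinter> z"
    using assms by (simp add: le_meet_iff meet_le2 meet_comm[of y x])
  then have "y \<leadsto> (y \<sqinter> x) \<sqsubseteq> y \<leadsto> (y \<sqinter> z)"
    using assms by (simp add: impl_mono_below_antecedent meet_le1)
  with le_impl_meet show ?thesis
    using assms by (meson impl_closed le_trans meet_closed)
qed

lemma meet_le_if_le_impl_meet:
  assumes "x \<in> carrier A" "y \<in> carrier A" "z \<in> carrier A" and "x \<sqsubseteq> y \<leadsto> (y \<sqinter> z)"
  shows "x \<sqinter> y \<sqsubseteq> z"
proof -
  have "x \<sqinter> y \<sqsubseteq> y \<leadsto> (y \<sqinter> z)"
    using assms by (meson impl_closed le_trans meet_closed meet_le1)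
  then have "x \<sqinter> y \<sqsubseteq> y \<sqinter> (y \<leadsto> (y \<sqinter> z))"
    using assms by (simp add: le_meet_iff meet_le2)
  then show ?thesis
    using assms by (simp add: meet_impl le_meet_iff)
qed

theorem heyting_algebra_heyting_of: "heyting_algebra (\<H> A)"
proof (intro heyting_algebra.intro heyting_algebra_axioms.intro)
  show "bounded_distrib_lattice_impl (\<H> A)"
    unfolding heyting_of_def by (simp add: bounded_distrib_lattice_impl_update)
next
  fix x y z
  assume "x \<in> carrier (\<H> A)" "y \<in> carrier (\<H> A)" "z \<in> carrier (\<H> A)"
  then have "x \<sqinter> y \<sqsubseteq> z \<longleftrightarrow> x \<sqsubseteq> y \<leadsto> (y \<sqinter> z)"
    by (auto simp: heyting_of_def intro: le_impl_meet_if_meet_le meet_le_if_le_impl_meet)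
  then show "x \<sqinter>\<^bsub>\<H> A\<^esub> y \<sqsubseteq>\<^bsub>\<H> A\<^esub> z \<longleftrightarrow> x \<sqsubseteq>\<^bsub>\<H> A\<^esub> y \<leadsto>\<^bsub>\<H> A\<^esub> z"
    by (simp add: heyting_of_def)
qed

end

sublocale connexive_heyting_algebra \<subseteq> compatible_impl_lattice
  by unfold_locales (fact C3 C4 C5)+

theorem theorem3p13:
  fixes A :: "('a, 'm) impl_algebra_scheme" (structure)
  assumes "connexive_heyting_algebra A"
  shows "heyting_algebra (\<H> A)"
proof -
  interpret connexive_heyting_algebra A by fact
  show ?thesis
    by (rule heyting_algebra_heyting_of)
qed

end
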